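(* Let $(X,\mathcal{A},\mu)$ be a measure space with $\mu(X)>0$ such that $X$ is not an atom. Then the annihilator graph $AG(\mathcal{M}(X,\mathcal{A}))$ is hypertriangulated if and only if the comaximal graph $\Gamma'_2(\mathcal{M}(X,\mathcal{A}))$ is triangulated.
   Context: $\mathcal{M}(X,\mathcal{A})$ is the commutative ring (pointwise operations) of all $\mathcal{A}$-measurable functions $f:X\to\mathbb{R}$; $Z(f)=\{x\in X:f(x)=0\}$. A set $A\in\mathcal{A}$ is an atom if $\mu(A)>0$ and $A$ cannot be written as a disjoint union $A=B\sqcup C$ with $B,C\in\mathcal{A}$, $\mu(B)>0$, $\mu(C)>0$. A function $u$ is a $\mu$-unit if $\mu(Z(u))=0$. Write $\mathscr{D}=\{f\in\mathcal{M}(X,\mathcal{A}):\mu(Z(f))>0\text{ and }\mu(X\setminus Z(f))>0\}$, and $ann(f)=\{g\in\mathcal{M}(X,\mathcal{A}): fg=0\ \mu\text{-a.e. on }X\}$. Both graphs are simple graphs with vertex set $\mathscr{D}$. Distinct $f,g\in\mathscr{D}$ are adjacent: in $AG$ iff $ann(f)\cup ann(g)\subsetneqq ann(fg)$; in $\Gamma'_2$ iff $\langle f\rangle+\langle g\rangle=\langle u\rangle$ (sum of principal ideals) for some $\mu$-unit $u$. A graph is triangulated if every vertex is a vertex of a triangle, and hypertriangulated if every edge is an edge of a triangle. *)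

theory Defs
  imports "HOL-Analysis.Analysis" "HOL-Algebra.Ideal"
begin

(* HOL functions are total on the type, so a function on X = space M is represented by its
   extension that is undefined off X; distinct ring elements thus differ at a point of X. *)
definition meas_ring :: "'a measure \<Rightarrow> ('a \<Rightarrow> real) ring" where
  "meas_ring M =
    \<lparr> carrier = borel_measurable M \<inter> extensional (space M),
      monoid.mult = (\<lambda>f g. \<lambda>x\<in>space M. f x * g x),
      one = (\<lambda>x\<in>space M. 1),
      zero = (\<lambda>x\<in>space M. 0),
      add = (\<lambda>f g. \<lambda>x\<in>space M. f x + g x) \<rparr>"

lemma restrict_borel_measurable_iff:
  "restrict f (space M) \<in> borel_measurable M \<longleftrightarrow> f \<in> borel_measurable M"
  by (rule measurable_cong) simp

lemma cring_meas_ring: "cring (meas_ring M)"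
proof (rule cringI)
  show "abelian_group (meas_ring M)"
  proof (rule abelian_groupI)
    fix f assume f: "f \<in> carrier (meas_ring M)"
    show "\<exists>g\<in>carrier (meas_ring M). g \<oplus>\<^bsub>meas_ring M\<^esub> f = \<zero>\<^bsub>meas_ring M\<^esub>"
      using f by (intro bexI[of _ "\<lambda>x\<in>space M. - f x"])
        (auto simp: meas_ring_def restrict_borel_measurable_iff fun_eq_iff restrict_def
          extensional_def)
  qed (auto simp: meas_ring_def restrict_borel_measurable_iff fun_eq_iff restrict_def
         extensional_def)
  show "comm_monoid (meas_ring M)"
    by (rule comm_monoidI) (auto simp: meas_ring_def restrict_borel_measurable_iff fun_eq_iff
      restrict_def extensional_def)
qed (auto simp: meas_ring_def fun_eq_iff restrict_def distrib_right)

definition zero_set :: "'a measure \<Rightarrow> ('a \<Rightarrow> real) \<Rightarrow> 'a set" where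
  "zero_set M f = {x \<in> space M. f x = 0}"

definition measure_atom :: "'a measure \<Rightarrow> 'a set \<Rightarrow> bool" where
  "measure_atom M A \<longleftrightarrow> A \<in> sets M \<and> emeasure M A > 0 \<and>
    \<not> (\<exists>B C. B \<in> sets M \<and> C \<in> sets M \<and> B \<inter> C = {} \<and> A = B \<union> C \<and>
          emeasure M B > 0 \<and> emeasure M C > 0)"

definition mu_unit :: "'a measure \<Rightarrow> ('a \<Rightarrow> real) \<Rightarrow> bool" where
  "mu_unit M u \<longleftrightarrow> u \<in> carrier (meas_ring M) \<and> emeasure M (zero_set M u) = 0"

definition zdiv_verts :: "'a measure \<Rightarrow> ('a \<Rightarrow> real) set" where
  "zdiv_verts M = {f \<in> carrier (meas_ring M).
     emeasure M (zero_set M f) > 0 \<and> emeasure M (space M - zero_set M f) > 0}"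

definition ann :: "'a measure \<Rightarrow> ('a \<Rightarrow> real) \<Rightarrow> ('a \<Rightarrow> real) set" where
  "ann M f = {g \<in> carrier (meas_ring M). AE x in M. (f \<otimes>\<^bsub>meas_ring M\<^esub> g) x = 0}"

record 'v sgraph =
  vertices :: "'v set"
  edges :: "'v set set"

definition simple_graph :: "'v sgraph \<Rightarrow> bool" where
  "simple_graph G \<longleftrightarrow> (\<forall>e\<in>edges G. \<exists>v w. e = {v, w} \<and> v \<noteq> w \<and> v \<in> vertices G \<and> w \<in> vertices G)"

definition triangle :: "'v sgraph \<Rightarrow> 'v \<Rightarrow> 'v \<Rightarrow> 'v \<Rightarrow> bool" where
  "triangle G u v w \<longleftrightarrow> u \<in> vertices G \<and> v \<in> vertices G \<and> w \<in> vertices G \<and>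
     u \<noteq> v \<and> v \<noteq> w \<and> u \<noteq> w \<and>
     {u, v} \<in> edges G \<and> {v, w} \<in> edges G \<and> {u, w} \<in> edges G"

definition triangulated :: "'v sgraph \<Rightarrow> bool" where
  "triangulated G \<longleftrightarrow> (\<forall>u\<in>vertices G. \<exists>v w. triangle G u v w)"

definition hypertriangulated :: "'v sgraph \<Rightarrow> bool" where
  "hypertriangulated G \<longleftrightarrow> (\<forall>e\<in>edges G. \<exists>u v w. e = {u, v} \<and> triangle G u v w)"

definition annihilator_graph :: "'a measure \<Rightarrow> ('a \<Rightarrow> real) sgraph" where
  "annihilator_graph M =
    \<lparr> vertices = zdiv_verts M,
      edges = {{f, g} | f g. f \<in> zdiv_verts M \<and> g \<in> zdiv_verts M \<and> f \<noteq> g \<and>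
                 ann M f \<union> ann M g \<subset> ann M (f \<otimes>\<^bsub>meas_ring M\<^esub> g)} \<rparr>"

definition comaximal_graph :: "'a measure \<Rightarrow> ('a \<Rightarrow> real) sgraph" where
  "comaximal_graph M =
    \<lparr> vertices = zdiv_verts M,
      edges = {{f, g} | f g. f \<in> zdiv_verts M \<and> g \<in> zdiv_verts M \<and> f \<noteq> g \<and>
                 (\<exists>u. mu_unit M u \<and>
                    PIdl\<^bsub>meas_ring M\<^esub> f <+>\<^bsub>meas_ring M\<^esub> PIdl\<^bsub>meas_ring M\<^esub> g = PIdl\<^bsub>meas_ring M\<^esub> u)} \<rparr>"

lemma simple_graph_annihilator_graph: "simple_graph (annihilator_graph M)"
  by (auto simp: simple_graph_def annihilator_graph_def)

lemma simple_graph_comaximal_graph: "simple_graph (comaximal_graph M)"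
  by (auto simp: simple_graph_def comaximal_graph_def)

end

theory Submission
  imports Defs
begin

text \<open>
  Up to null sets, both adjacency relations only see zero sets: \<open>f\<close> and \<open>g\<close> are adjacent in the
  annihilator graph iff \<open>Z(f)\<close> and \<open>Z(g)\<close> are incomparable, and in the comaximal graph iff they are
  disjoint. Both sides of the equivalence then say that there are no atoms at all. If \<open>A\<close> is an
  atom, then \<open>X - A\<close> is not null because \<open>X\<close> is not an atom; the edge joining \<open>A\<close> and \<open>X - A\<close>
  lies in no triangle of the annihilator graph, since any set is comparable to one of them, and the
  vertex \<open>X - A\<close> lies in no triangle of the comaximal graph. Without atoms, the triangles are found
  by splitting \<open>Z(f) - Z(g)\<close> and \<open>Z(g) - Z(f)\<close>, respectively \<open>X - Z(f)\<close>, into two non-null parts.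
\<close>

section \<open>Sets of positive measure and atoms\<close>

lemma emeasure_pos_iff_not_AE:
  assumes "A \<in> sets M"
  shows "emeasure M A > 0 \<longleftrightarrow> \<not> (AE x in M. x \<notin> A)"
  using AE_iff_null_sets[OF assms] assms by (auto simp: null_sets_def zero_less_iff_neq_zero)

lemma emeasure_pos_mono:
  assumes "emeasure M A > 0" "A \<subseteq> B" "B \<in> sets M"
  shows "emeasure M B > 0"
  using emeasure_mono[OF assms(2,3)] assms(1) by order

text \<open>Subadditivity suffices; as no measures are subtracted, \<open>A\<close> may have
  infinite measure.\<close>

lemma emeasure_pos_Int:
  assumes "emeasure M A > 0" "emeasure M (A - B) = 0" "A \<in> sets M" "B \<in> sets M"
  shows "emeasure M (A \<inter> B) > 0"
proof -
  have "emeasure M A \<le> emeasure M (A \<inter> B) + emeasure M (A - B)"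
    using emeasure_subadditive[of "A \<inter> B" M "A - B"] assms by (simp add: Int_Diff_Un)
  then show ?thesis
    using assms(1,2) by simp
qed

text \<open>Any measurable \<open>B\<close> cuts an atom into two disjoint pieces. This is the form
  in which atoms are used below.\<close>

lemma measure_atom_Int_Diff:
  assumes "measure_atom M A" "B \<in> sets M"
  shows "emeasure M (A \<inter> B) = 0 \<or> emeasure M (A - B) = 0"
proof -
  have "A \<inter> B \<in> sets M" "A - B \<in> sets M" "(A \<inter> B) \<inter> (A - B) = {}" "A = (A \<inter> B) \<union> (A - B)"
    using assms by (auto simp: measure_atom_def)
  then have "\<not> (emeasure M (A \<inter> B) > 0 \<and> emeasure M (A - B) > 0)"
    using assms(1) unfolding measure_atom_def by blast
  then show ?thesis
    by (auto simp: zero_less_iff_neq_zero)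
qed

lemma not_measure_atomE:
  assumes "\<not> measure_atom M A" "A \<in> sets M" "emeasure M A > 0"
  obtains B C where "B \<in> sets M" "C \<in> sets M" "B \<inter> C = {}" "A = B \<union> C"
    "emeasure M B > 0" "emeasure M C > 0"
  using assms unfolding measure_atom_def by blast

text \<open>Used in contrapositive form: when the whole space is not an atom, the complement of an
  atom is not null, so the atom and its complement are both zero sets of vertices.\<close>

lemma measure_atom_space:
  assumes "measure_atom M A" "emeasure M (space M - A) = 0"
  shows "measure_atom M (space M)"
  unfolding measure_atom_def
proof (intro conjI notI)
  have A: "A \<in> sets M" "emeasure M A > 0"
    using assms(1) by (auto simp: measure_atom_def)
  show "emeasure M (space M) > 0"
    using emeasure_pos_mono[OF A(2) sets.sets_into_space[OF A(1)]] by simp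
  assume "\<exists>B C. B \<in> sets M \<and> C \<in> sets M \<and> B \<inter> C = {} \<and> space M = B \<union> C \<and>
    emeasure M B > 0 \<and> emeasure M C > 0"
  then obtain B C where BC: "B \<in> sets M" "C \<in> sets M" "B \<inter> C = {}" "space M = B \<union> C"
    "emeasure M B > 0" "emeasure M C > 0"
    by blast
  \<comment> \<open>A non-null set keeps positive measure inside \<open>A\<close>, since it loses
    only part of a null set. A splitting of the space therefore induces one of the atom.\<close>
  have pos: "emeasure M (A \<inter> D) > 0" if "D \<in> sets M" "emeasure M D > 0" for D
  proof -
    have "emeasure M (D - A) \<le> emeasure M (space M - A)"
      using that A sets.sets_into_space by (intro emeasure_mono) auto
    then show ?thesis
      using emeasure_pos_Int[of M D A] that A assms(2) by (simp add: Int_commute)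
  qed
  have "A - B = A \<inter> C"
    using sets.sets_into_space[OF A(1)] BC by auto
  then show False
    using measure_atom_Int_Diff[OF assms(1) BC(1)] pos[of B] pos[of C] BC by auto
qed simp

section \<open>Ring elements and their zero sets\<close>

lemma meas_ring_carrier_iff:
  "f \<in> carrier (meas_ring M) \<longleftrightarrow> f \<in> borel_measurable M \<and> f \<in> extensional (space M)"
  by (auto simp: meas_ring_def)

lemma restrict_in_meas_ring:
  "f \<in> borel_measurable M \<Longrightarrow> restrict f (space M) \<in> carrier (meas_ring M)"
  by (simp add: meas_ring_carrier_iff restrict_borel_measurable_iff)

lemma zero_set_sets:
  assumes "f \<in> carrier (meas_ring M)"
  shows "zero_set M f \<in> sets M"
proof -
  have [measurable]: "f \<in> borel_measurable M"
    using assms by (simp add: meas_ring_carrier_iff)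
  show ?thesis
    unfolding zero_set_def by measurable
qed

text \<open>The indicator of the complement has the prescribed zero set. Vertices can thus be
  constructed by choosing sets.\<close>

lemma exists_zero_set:
  assumes "A \<in> sets M"
  obtains f where "f \<in> carrier (meas_ring M)" "zero_set M f = A"
proof
  show "restrict (indicator (space M - A)) (space M) \<in> carrier (meas_ring M)"
    using assms by (intro restrict_in_meas_ring borel_measurable_indicator) auto
  show "zero_set M (restrict (indicator (space M - A)) (space M)) = A"
    using sets.sets_into_space[OF assms] by (auto simp: zero_set_def indicator_def split: if_splits)
qed

lemma exists_zdiv_vert:
  assumes "A \<in> sets M" "emeasure M A > 0" "emeasure M (space M - A) > 0"
  obtains f where "f \<in> zdiv_verts M" "zero_set M f = A"
  using exists_zero_set[OF assms(1)] assms(2,3) unfolding zdiv_verts_def by blast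

section \<open>Annihilators and adjacency in the annihilator graph\<close>

lemma in_ann_iff:
  "g \<in> ann M f \<longleftrightarrow> g \<in> carrier (meas_ring M) \<and> (AE x in M. f x * g x = 0)"
  unfolding ann_def by (auto simp: meas_ring_def cong: AE_cong_simp)

lemma in_ann_mult_iff:
  "h \<in> ann M (f \<otimes>\<^bsub>meas_ring M\<^esub> g) \<longleftrightarrow>
    h \<in> carrier (meas_ring M) \<and> (AE x in M. f x * g x * h x = 0)"
  unfolding in_ann_iff by (auto simp: meas_ring_def cong: AE_cong_simp)

text \<open>Almost everywhere off the zero set of \<open>f\<close>, \<open>g\<close> is nonzero too
  and can be cancelled from \<open>f * g * h = 0\<close>.\<close>

lemma ann_mult_subset:
  assumes "emeasure M (zero_set M g - zero_set M f) = 0"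
    "f \<in> carrier (meas_ring M)" "g \<in> carrier (meas_ring M)"
  shows "ann M (f \<otimes>\<^bsub>meas_ring M\<^esub> g) \<subseteq> ann M f"
proof
  fix h assume h: "h \<in> ann M (f \<otimes>\<^bsub>meas_ring M\<^esub> g)"
  have "AE x in M. x \<notin> zero_set M g - zero_set M f"
    using emeasure_pos_iff_not_AE[of "zero_set M g - zero_set M f" M] assms zero_set_sets by auto
  moreover have "AE x in M. f x * g x * h x = 0"
    using h by (simp add: in_ann_mult_iff)
  ultimately have "AE x in M. f x * h x = 0"
    using AE_space by eventually_elim (auto simp: zero_set_def)
  then show "h \<in> ann M f"
    using h by (simp add: in_ann_iff in_ann_mult_iff)
qed

lemma not_in_annI:
  assumes "emeasure M A > 0" "A \<in> sets M" "\<And>x. x \<in> A \<Longrightarrow> f x \<noteq> 0 \<and> h x \<noteq> 0"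
  shows "h \<notin> ann M f"
proof
  assume "h \<in> ann M f"
  then have "AE x in M. f x * h x = 0"
    by (simp add: in_ann_iff)
  then have "AE x in M. x \<notin> A"
    by eventually_elim (use assms(3) in auto)
  then show False
    using emeasure_pos_iff_not_AE[OF assms(2)] assms(1) by blast
qed

text \<open>If one difference is null, the annihilator of the product collapses into that of one
  factor. If neither is, a function supported on the symmetric difference of the zero sets kills the
  product but neither factor.\<close>

lemma ann_Un_psubset_iff:
  assumes f: "f \<in> carrier (meas_ring M)" and g: "g \<in> carrier (meas_ring M)"
  shows "ann M f \<union> ann M g \<subset> ann M (f \<otimes>\<^bsub>meas_ring M\<^esub> g) \<longleftrightarrow>
    emeasure M (zero_set M f - zero_set M g) > 0 \<and> emeasure M (zero_set M g - zero_set M f) > 0"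
    (is "?L \<longleftrightarrow> ?R")
proof
  assume L: ?L
  interpret cring "meas_ring M"
    by (rule cring_meas_ring)
  have "emeasure M (zero_set M g - zero_set M f) \<noteq> 0"
    using ann_mult_subset[of M g f] L f g by blast
  moreover have "emeasure M (zero_set M f - zero_set M g) \<noteq> 0"
    using ann_mult_subset[of M f g] L f g by (auto simp: m_comm)
  ultimately show ?R
    by (simp add: zero_less_iff_neq_zero)
next
  assume R: ?R
  let ?A = "zero_set M f - zero_set M g" and ?B = "zero_set M g - zero_set M f"
  have sets: "?A \<in> sets M" "?B \<in> sets M"
    using zero_set_sets[OF f] zero_set_sets[OF g] by auto
  \<comment> \<open>The witness \<open>h\<close> is nonzero exactly on
    \<open>?A \<union> ?B\<close>. There \<open>f * g\<close> vanishes, but \<open>f\<close> is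
    nonzero on \<open>?B\<close> and \<open>g\<close> is nonzero on \<open>?A\<close>.\<close>
  have "space M - (?A \<union> ?B) \<in> sets M"
    using sets by auto
  then obtain h where h: "h \<in> carrier (meas_ring M)" "zero_set M h = space M - (?A \<union> ?B)"
    using exists_zero_set by metis
  have "h x \<noteq> 0 \<longleftrightarrow> x \<in> ?A \<union> ?B" if "x \<in> space M" for x
    using h(2) that unfolding set_eq_iff zero_set_def by auto
  then have hx: "h x \<noteq> 0 \<longleftrightarrow> f x = 0 \<and> g x \<noteq> 0 \<or> g x = 0 \<and> f x \<noteq> 0" if "x \<in> space M" for x
    using that by (auto simp: zero_set_def)
  have "h \<in> ann M (f \<otimes>\<^bsub>meas_ring M\<^esub> g)"
    unfolding in_ann_mult_iff using h(1) hx by (auto intro!: AE_I2)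
  moreover have "h \<notin> ann M f"
    by (rule not_in_annI[of M ?B]) (use R sets hx in \<open>auto simp: zero_set_def\<close>)
  moreover have "h \<notin> ann M g"
    by (rule not_in_annI[of M ?A]) (use R sets hx in \<open>auto simp: zero_set_def\<close>)
  moreover have "ann M f \<union> ann M g \<subseteq> ann M (f \<otimes>\<^bsub>meas_ring M\<^esub> g)"
    unfolding subset_iff Un_iff in_ann_mult_iff
    by (auto simp: in_ann_iff elim!: eventually_mono)
  ultimately show ?L
    by blast
qed

lemma annihilator_edge_iff:
  assumes "f \<in> zdiv_verts M" "g \<in> zdiv_verts M"
  shows "{f, g} \<in> edges (annihilator_graph M) \<longleftrightarrow>
    emeasure M (zero_set M f - zero_set M g) > 0 \<and> emeasure M (zero_set M g - zero_set M f) > 0"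
proof -
  have "f \<in> carrier (meas_ring M)" "g \<in> carrier (meas_ring M)"
    using assms by (auto simp: zdiv_verts_def)
  \<comment> \<open>Both orders are needed because an edge is an unordered pair.\<close>
  note iff = ann_Un_psubset_iff[OF this] ann_Un_psubset_iff[OF this(2,1)]
  show ?thesis (is "?L \<longleftrightarrow> ?R")
  proof
    assume ?L
    then show ?R
      using iff by (auto simp: annihilator_graph_def doubleton_eq_iff)
  next
    assume ?R
    then have "f \<noteq> g"
      by auto
    then show ?L
      using assms iff(1)[THEN iffD2, OF \<open>?R\<close>]
      unfolding annihilator_graph_def sgraph.select_convs by blast
  qed
qed

section \<open>Sums of principal ideals and adjacency in the comaximal graph\<close>

lemma PIdl_meas_ring:
  "PIdl\<^bsub>meas_ring M\<^esub> f = {\<lambda>x\<in>space M. r x * f x | r. r \<in> carrier (meas_ring M)}"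
  by (auto simp: cgenideal_def) (auto simp: meas_ring_def)

lemma PIdl_add_meas_ring:
  "PIdl\<^bsub>meas_ring M\<^esub> f <+>\<^bsub>meas_ring M\<^esub> PIdl\<^bsub>meas_ring M\<^esub> g =
    {\<lambda>x\<in>space M. r x * f x + s x * g x | r s.
      r \<in> carrier (meas_ring M) \<and> s \<in> carrier (meas_ring M)}"
proof -
  have add: "(\<lambda>x\<in>space M. r x * f x) \<oplus>\<^bsub>meas_ring M\<^esub> (\<lambda>x\<in>space M. s x * g x) =
      (\<lambda>x\<in>space M. r x * f x + s x * g x)" for r s
    by (auto simp: meas_ring_def)
  show ?thesis
    unfolding set_add_def' PIdl_meas_ring Setcompr_eq_image by (simp add: add) blast
qed

text \<open>Measurable functions can be divided pointwise, and the sum of squares vanishes only at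
  common zeros, where every element of the ideal sum vanishes as well.\<close>

lemma PIdl_add_eq_PIdl_sum_squares:
  assumes f: "f \<in> carrier (meas_ring M)" and g: "g \<in> carrier (meas_ring M)"
  shows "PIdl\<^bsub>meas_ring M\<^esub> f <+>\<^bsub>meas_ring M\<^esub> PIdl\<^bsub>meas_ring M\<^esub> g =
    PIdl\<^bsub>meas_ring M\<^esub> (\<lambda>x\<in>space M. (f x)\<^sup>2 + (g x)\<^sup>2)" (is "?I = PIdl\<^bsub>meas_ring M\<^esub> ?u")
proof (intro equalityI subsetI)
  have [measurable]: "f \<in> borel_measurable M" "g \<in> borel_measurable M"
    using f g by (auto simp: meas_ring_carrier_iff)
  fix h
  {
    assume "h \<in> ?I"
    then obtain r s where h: "h = (\<lambda>x\<in>space M. r x * f x + s x * g x)"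
      and rs: "r \<in> carrier (meas_ring M)" "s \<in> carrier (meas_ring M)"
      unfolding PIdl_add_meas_ring by blast
    have [measurable]: "r \<in> borel_measurable M" "s \<in> borel_measurable M"
      using rs by (auto simp: meas_ring_carrier_iff)
    \<comment> \<open>At common zeros the quotient takes the HOL value 0 of division by 0, which is
      harmless since \<open>h\<close> is 0 there.\<close>
    let ?q = "\<lambda>x\<in>space M. (r x * f x + s x * g x) / ((f x)\<^sup>2 + (g x)\<^sup>2)"
    have "?q \<in> carrier (meas_ring M)"
      by (rule restrict_in_meas_ring) measurable
    moreover have "h = (\<lambda>x\<in>space M. ?q x * ?u x)"
      unfolding h by (rule restrict_ext) (auto simp: sum_power2_eq_zero_iff)
    ultimately show "h \<in> PIdl\<^bsub>meas_ring M\<^esub> ?u"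
      unfolding PIdl_meas_ring by blast
  next
    assume "h \<in> PIdl\<^bsub>meas_ring M\<^esub> ?u"
    then obtain q where h: "h = (\<lambda>x\<in>space M. q x * ?u x)" and q: "q \<in> carrier (meas_ring M)"
      unfolding PIdl_meas_ring by blast
    have [measurable]: "q \<in> borel_measurable M"
      using q by (auto simp: meas_ring_carrier_iff)
    let ?r = "\<lambda>x\<in>space M. q x * f x" and ?s = "\<lambda>x\<in>space M. q x * g x"
    have "?r \<in> carrier (meas_ring M)" "?s \<in> carrier (meas_ring M)"
      by (rule restrict_in_meas_ring; measurable)+
    moreover have "h = (\<lambda>x\<in>space M. ?r x * f x + ?s x * g x)"
      unfolding h by (rule restrict_ext) (auto simp: power2_eq_square algebra_simps)
    ultimately show "h \<in> ?I"
      unfolding PIdl_add_meas_ring by blast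
  }
qed

text \<open>A generator \<open>u\<close> lies in the sum and so vanishes at all common zeros;
  conversely, the sum of squares is a generator whose zeros are exactly these.\<close>

lemma PIdl_add_eq_PIdl_mu_unit_iff:
  assumes f: "f \<in> carrier (meas_ring M)" and g: "g \<in> carrier (meas_ring M)"
  shows "(\<exists>u. mu_unit M u \<and>
      PIdl\<^bsub>meas_ring M\<^esub> f <+>\<^bsub>meas_ring M\<^esub> PIdl\<^bsub>meas_ring M\<^esub> g = PIdl\<^bsub>meas_ring M\<^esub> u) \<longleftrightarrow>
    emeasure M (zero_set M f \<inter> zero_set M g) = 0" (is "?L \<longleftrightarrow> ?R")
proof
  assume ?L
  then obtain u where u: "mu_unit M u" and
    eq: "PIdl\<^bsub>meas_ring M\<^esub> f <+>\<^bsub>meas_ring M\<^esub> PIdl\<^bsub>meas_ring M\<^esub> g = PIdl\<^bsub>meas_ring M\<^esub> u"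
    by blast
  have uc: "u \<in> carrier (meas_ring M)" and u0: "emeasure M (zero_set M u) = 0"
    using u by (auto simp: mu_unit_def)
  interpret cring "meas_ring M"
    by (rule cring_meas_ring)
  have "u \<in> PIdl\<^bsub>meas_ring M\<^esub> f <+>\<^bsub>meas_ring M\<^esub> PIdl\<^bsub>meas_ring M\<^esub> g"
    unfolding eq by (rule cgenideal_self[OF uc])
  then have "zero_set M f \<inter> zero_set M g \<subseteq> zero_set M u"
    unfolding PIdl_add_meas_ring by (auto simp: zero_set_def)
  then show ?R
    using emeasure_mono[OF _ zero_set_sets[OF uc]] u0 by fastforce
next
  assume ?R
  let ?u = "\<lambda>x\<in>space M. (f x)\<^sup>2 + (g x)\<^sup>2"
  have [measurable]: "f \<in> borel_measurable M" "g \<in> borel_measurable M"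
    using f g by (auto simp: meas_ring_carrier_iff)
  have "?u \<in> carrier (meas_ring M)"
    by (rule restrict_in_meas_ring) measurable
  moreover have "zero_set M ?u = zero_set M f \<inter> zero_set M g"
    by (auto simp: zero_set_def sum_power2_eq_zero_iff)
  ultimately have "mu_unit M ?u"
    using \<open>?R\<close> by (simp add: mu_unit_def)
  then show ?L
    using PIdl_add_eq_PIdl_sum_squares[OF f g] by blast
qed

lemma comaximal_edge_iff:
  assumes "f \<in> zdiv_verts M" "g \<in> zdiv_verts M"
  shows "{f, g} \<in> edges (comaximal_graph M) \<longleftrightarrow> emeasure M (zero_set M f \<inter> zero_set M g) = 0"
proof -
  have "f \<in> carrier (meas_ring M)" "g \<in> carrier (meas_ring M)" "emeasure M (zero_set M f) > 0"
    using assms by (auto simp: zdiv_verts_def)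
  note iff = PIdl_add_eq_PIdl_mu_unit_iff[OF this(1,2)] PIdl_add_eq_PIdl_mu_unit_iff[OF this(2,1)]
    and pos = this(3)
  show ?thesis (is "?L \<longleftrightarrow> ?R")
  proof
    assume ?L
    then show ?R
      using iff by (auto simp: comaximal_graph_def doubleton_eq_iff Int_commute)
  next
    assume ?R
    \<comment> \<open>If \<open>f\<close> and \<open>g\<close> were equal, the intersection would be
      the zero set of a vertex, which is not null.\<close>
    then have "f \<noteq> g"
      using pos by auto
    then show ?L
      using assms iff(1) \<open>?R\<close> unfolding comaximal_graph_def by auto
  qed
qed

section \<open>Triangles in the two graphs and their relation to atoms\<close>

lemma zdiv_vertsD:
  assumes "f \<in> zdiv_verts M"
  shows "zero_set M f \<in> sets M" "emeasure M (zero_set M f) > 0"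
    "emeasure M (space M - zero_set M f) > 0" "zero_set M f \<subseteq> space M"
  using assms zero_set_sets by (auto simp: zdiv_verts_def zero_set_def)

lemma vertices_simps [simp]:
  "vertices (annihilator_graph M) = zdiv_verts M" "vertices (comaximal_graph M) = zdiv_verts M"
  by (simp_all add: annihilator_graph_def comaximal_graph_def)

lemma annihilator_graph_edgeE:
  assumes "e \<in> edges (annihilator_graph M)"
  obtains f g where "e = {f, g}" "f \<in> zdiv_verts M" "g \<in> zdiv_verts M"
  using assms by (auto simp: annihilator_graph_def)

text \<open>Edges join distinct vertices, so the inequalities in \<open>triangle\<close> come for
  free.\<close>

lemma annihilator_triangle_iff:
  "triangle (annihilator_graph M) f g h \<longleftrightarrow>
    f \<in> zdiv_verts M \<and> g \<in> zdiv_verts M \<and> h \<in> zdiv_verts M \<and>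
    {f, g} \<in> edges (annihilator_graph M) \<and> {g, h} \<in> edges (annihilator_graph M) \<and>
    {f, h} \<in> edges (annihilator_graph M)"
  unfolding triangle_def by (auto simp: annihilator_graph_def)

lemma comaximal_triangle_iff:
  "triangle (comaximal_graph M) f g h \<longleftrightarrow>
    f \<in> zdiv_verts M \<and> g \<in> zdiv_verts M \<and> h \<in> zdiv_verts M \<and>
    {f, g} \<in> edges (comaximal_graph M) \<and> {g, h} \<in> edges (comaximal_graph M) \<and>
    {f, h} \<in> edges (comaximal_graph M)"
  unfolding triangle_def by (auto simp: comaximal_graph_def)

lemma hypertriangulated_annihilator_iff:
  assumes "\<not> measure_atom M (space M)"
  shows "hypertriangulated (annihilator_graph M) \<longleftrightarrow> (\<forall>A. \<not> measure_atom M A)"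
proof (intro iffI allI notI)
  fix A assume hyper: "hypertriangulated (annihilator_graph M)" and atom: "measure_atom M A"
  have A: "A \<in> sets M" "emeasure M A > 0" "A \<subseteq> space M"
    using atom sets.sets_into_space by (auto simp: measure_atom_def)
  have pos: "emeasure M (space M - A) > 0"
    using measure_atom_space[OF atom] assms by (auto simp: zero_less_iff_neq_zero)
  have [simp]: "space M - (space M - A) = A"
    using A by auto
  obtain f where f: "f \<in> zdiv_verts M" "zero_set M f = A"
    using exists_zdiv_vert[OF A(1,2) pos] by blast
  obtain g where g: "g \<in> zdiv_verts M" "zero_set M g = space M - A"
    using exists_zdiv_vert[of "space M - A" M] A pos by auto
  have "A - (space M - A) = A" "(space M - A) - A = space M - A"
    by auto
  then have "{f, g} \<in> edges (annihilator_graph M)"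
    using annihilator_edge_iff[OF f(1) g(1)] f g A pos by simp
  then obtain u v h where "{f, g} = {u, v}" and "triangle (annihilator_graph M) u v h"
    using hyper unfolding hypertriangulated_def by blast
  then have h: "h \<in> zdiv_verts M" "{f, h} \<in> edges (annihilator_graph M)"
      "{g, h} \<in> edges (annihilator_graph M)"
    by (auto simp: annihilator_triangle_iff doubleton_eq_iff)
  let ?H = "zero_set M h"
  have H: "?H \<in> sets M" "?H \<subseteq> space M"
    using zdiv_vertsD[OF h(1)] by auto
  have "emeasure M (A - ?H) > 0"
    using h(2) annihilator_edge_iff[OF f(1) h(1)] f by simp
  moreover have "emeasure M (?H - (space M - A)) > 0"
    using h(3) annihilator_edge_iff[OF g(1) h(1)] g by simp
  \<comment> \<open>Adjacency of \<open>h\<close> to both ends of the edge thus makes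
    \<open>?H\<close> split the atom into two non-null pieces.\<close>
  moreover have "?H - (space M - A) = A \<inter> ?H"
    using H A by auto
  ultimately show False
    using measure_atom_Int_Diff[OF atom H(1)] by auto
next
  assume atomless: "\<forall>A. \<not> measure_atom M A"
  show "hypertriangulated (annihilator_graph M)"
    unfolding hypertriangulated_def
  proof
    fix e assume e: "e \<in> edges (annihilator_graph M)"
    then obtain f g where fg: "e = {f, g}" "f \<in> zdiv_verts M" "g \<in> zdiv_verts M"
      by (rule annihilator_graph_edgeE)
    let ?F = "zero_set M f" and ?G = "zero_set M g"
    have sets: "?F \<in> sets M" "?G \<in> sets M" "?F \<subseteq> space M" "?G \<subseteq> space M"
      using zdiv_vertsD[OF fg(2)] zdiv_vertsD[OF fg(3)] by blast+
    have pos: "emeasure M (?F - ?G) > 0" "emeasure M (?G - ?F) > 0"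
      using e fg annihilator_edge_iff[OF fg(2,3)] by auto
    obtain P Q where PQ: "P \<in> sets M" "Q \<in> sets M" "P \<inter> Q = {}" "?F - ?G = P \<union> Q"
        "emeasure M P > 0" "emeasure M Q > 0"
      using not_measure_atomE[of M "?F - ?G"] atomless sets pos by blast
    obtain R S where RS: "R \<in> sets M" "S \<in> sets M" "R \<inter> S = {}" "?G - ?F = R \<union> S"
        "emeasure M R > 0" "emeasure M S > 0"
      using not_measure_atomE[of M "?G - ?F"] atomless sets pos by blast
    \<comment> \<open>The zero set of the third vertex takes one half of each difference.
      \<open>P\<close> and \<open>R\<close> witness what it has beyond \<open>?G\<close> and
      \<open>?F\<close>; \<open>Q\<close> and \<open>S\<close> witness what it misses of
      \<open>?F\<close> and \<open>?G\<close>.\<close>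
    have "emeasure M (P \<union> R) > 0"
      by (rule emeasure_pos_mono[OF PQ(5)]) (use PQ RS in auto)
    moreover have "emeasure M (space M - (P \<union> R)) > 0"
      by (rule emeasure_pos_mono[OF PQ(6)]) (use PQ RS sets in auto)
    ultimately obtain h where h: "h \<in> zdiv_verts M" "zero_set M h = P \<union> R"
      using exists_zdiv_vert[of "P \<union> R" M] PQ RS by auto
    have "emeasure M (?F - (P \<union> R)) > 0"
      by (rule emeasure_pos_mono[OF PQ(6)]) (use PQ RS sets in auto)
    moreover have "emeasure M ((P \<union> R) - ?F) > 0"
      by (rule emeasure_pos_mono[OF RS(5)]) (use PQ RS sets in auto)
    moreover have "emeasure M (?G - (P \<union> R)) > 0"
      by (rule emeasure_pos_mono[OF RS(6)]) (use PQ RS sets in auto)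
    moreover have "emeasure M ((P \<union> R) - ?G) > 0"
      by (rule emeasure_pos_mono[OF PQ(5)]) (use PQ RS sets in auto)
    ultimately have "triangle (annihilator_graph M) f g h"
      using e fg h by (simp add: annihilator_triangle_iff annihilator_edge_iff)
    then show "\<exists>u v w. e = {u, v} \<and> triangle (annihilator_graph M) u v w"
      using fg(1) by blast
  qed
qed

lemma triangulated_comaximal_iff:
  assumes "\<not> measure_atom M (space M)"
  shows "triangulated (comaximal_graph M) \<longleftrightarrow> (\<forall>A. \<not> measure_atom M A)"
proof (intro iffI allI notI)
  fix A assume tri: "triangulated (comaximal_graph M)" and atom: "measure_atom M A"
  have A: "A \<in> sets M" "emeasure M A > 0" "A \<subseteq> space M"
    using atom sets.sets_into_space by (auto simp: measure_atom_def)
  have pos: "emeasure M (space M - A) > 0"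
    using measure_atom_space[OF atom] assms by (auto simp: zero_less_iff_neq_zero)
  have [simp]: "space M - (space M - A) = A"
    using A by auto
  obtain f where f: "f \<in> zdiv_verts M" "zero_set M f = space M - A"
    using exists_zdiv_vert[of "space M - A" M] A pos by auto
  obtain g h where "triangle (comaximal_graph M) f g h"
    using tri f(1) unfolding triangulated_def by auto
  then have gh: "g \<in> zdiv_verts M" "h \<in> zdiv_verts M"
    and null: "emeasure M (zero_set M f \<inter> zero_set M g) = 0"
      "emeasure M (zero_set M f \<inter> zero_set M h) = 0"
      "emeasure M (zero_set M g \<inter> zero_set M h) = 0"
    by (auto simp: comaximal_triangle_iff comaximal_edge_iff)
  let ?G = "zero_set M g" and ?H = "zero_set M h"
  note G = zdiv_vertsD[OF gh(1)] and H = zdiv_vertsD[OF gh(2)]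
  \<comment> \<open>Both \<open>?G\<close> and \<open>?H\<close> lie in \<open>A\<close> up to null
    sets, hence meet it in positive measure.\<close>
  have "zero_set M f \<inter> ?G = ?G - A" "zero_set M f \<inter> ?H = ?H - A"
    using f G H by auto
  then have Gpos: "emeasure M (A \<inter> ?G) > 0" and Hpos: "emeasure M (?H \<inter> A) > 0"
    using emeasure_pos_Int[of M ?G A] emeasure_pos_Int[of M ?H A] A G H null
    by (simp_all add: Int_commute)
  \<comment> \<open>Since \<open>?G\<close> and \<open>?H\<close> are almost disjoint, almost all of
    \<open>?H \<inter> A\<close> lies in \<open>A - ?G\<close>. So \<open>?G\<close> splits the
    atom.\<close>
  have "emeasure M (?H \<inter> A - (A - ?G)) \<le> emeasure M (?G \<inter> ?H)"
    using G H by (intro emeasure_mono) auto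
  then have "emeasure M (?H \<inter> A \<inter> (A - ?G)) > 0"
    using emeasure_pos_Int[OF Hpos, of "A - ?G"] null A G H by simp
  then have "emeasure M (A - ?G) > 0"
    by (rule emeasure_pos_mono) (use A G in auto)
  then show False
    using measure_atom_Int_Diff[OF atom G(1)] Gpos by auto
next
  assume atomless: "\<forall>A. \<not> measure_atom M A"
  show "triangulated (comaximal_graph M)"
    unfolding triangulated_def vertices_simps
  proof
    fix f assume f: "f \<in> zdiv_verts M"
    note F = zdiv_vertsD[OF f]
    \<comment> \<open>The two pieces become the zero sets of the other vertices. Each piece lies in
      the complement of the other, so both complements are non-null.\<close>
    obtain B C where BC: "B \<in> sets M" "C \<in> sets M" "B \<inter> C = {}" "space M - zero_set M f = B \<union> C"
        "emeasure M B > 0" "emeasure M C > 0"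
      using not_measure_atomE[of M "space M - zero_set M f"] atomless F by blast
    have "emeasure M (space M - B) > 0"
      by (rule emeasure_pos_mono[OF BC(6)]) (use BC in auto)
    then obtain g where g: "g \<in> zdiv_verts M" "zero_set M g = B"
      using exists_zdiv_vert BC by metis
    have "emeasure M (space M - C) > 0"
      by (rule emeasure_pos_mono[OF BC(5)]) (use BC in auto)
    then obtain h where h: "h \<in> zdiv_verts M" "zero_set M h = C"
      using exists_zdiv_vert BC by metis
    have "zero_set M f \<inter> B = {}" "zero_set M f \<inter> C = {}"
      using BC(4) by auto
    then have "triangle (comaximal_graph M) f g h"
      using f g h BC(3) by (simp add: comaximal_triangle_iff comaximal_edge_iff)
    then show "\<exists>g h. triangle (comaximal_graph M) f g h"
      by blast
  qed
qed

theorem corollary4p17: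
  fixes M :: "'a measure"
  assumes "emeasure M (space M) > 0"
    and "\<not> measure_atom M (space M)"
  shows "hypertriangulated (annihilator_graph M) \<longleftrightarrow> triangulated (comaximal_graph M)"
  using hypertriangulated_annihilator_iff[OF assms(2)] triangulated_comaximal_iff[OF assms(2)]
  by simp

end
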